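(* For all $n\ge1$ and $\mathbf a=(a_1,\dots,a_n)\in\mathbb N^n$ with $a_1\ne0$, $$f^{(n)}(\mathbf a;x)=\frac1x+\sum_{\mathbf b\le_{\mathrm c}\mathbf a}k_{\mathbf a,\mathbf b}\,\widetilde f^{(\ell(\mathbf b))}(\mathbf b;x),$$ where $\mathbf b\le_{\mathrm c}\mathbf a$ means that $\mathbf b$ can be obtained from $\mathbf a$ by deleting some (possibly empty) subset of the zero entries of $\mathbf a$, the sum is over distinct such vectors $\mathbf b$, $\ell(\mathbf b)$ is the length of $\mathbf b$, and $k_{\mathbf a,\mathbf b}$ is the number of subsets of the zero entries of $\mathbf a$ whose deletion yields $\mathbf b$.
   Context: $\mathbb N=\{0,1,2,\dots\}$, $[n]=\{1,\dots,n\}$. For $n\ge1$, $K_{n+1}$ is the directed graph on $v_1,\dots,v_{n+1}$ with one edge $(v_i,v_j)$ for each $1\le i<j\le n+1$. For $\mathbf a\in\mathbb N^n$, an $\mathbf a$-flow is a function $f:E(K_{n+1})\to\mathbb R_{\ge0}$ with $\sum_{j>i}f(v_i,v_j)-\sum_{k<i}f(v_k,v_i)=a_i$ for all $i\in[n]$. $\mathrm{Flow}_n(\mathbf a)\subset\mathbb R^{E(K_{n+1})}$ is the polytope of all $\mathbf a$-flows. Its $f$-polynomial is the Laurent polynomial $f^{(n)}(\mathbf a;x)=\sum_{d\ge-1}f_d\,x^d$, where $f_d$ is the number of $d$-dimensional faces (the empty face counts as a face of dimension $-1$, and the polytope itself counts as a face). A subgraph $H\subseteq K_{n+1}$ is $\mathbf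 a$-valid if its edge set is the support $\{e:f(e)>0\}$ of some $\mathbf a$-flow (its vertex set being the set of endpoints of these edges). $H$ is primitive if it is connected (as an undirected graph) and $V(H)=\{v_1,\dots,v_{n+1}\}$. The first Betti number is $\beta_1(H)=|E(H)|-|V(H)|+c(H)$, with $c(H)$ the number of connected components. The primitive $f$-polynomial of $\mathrm{Flow}_n(\mathbf a)$ is $\widetilde f^{(n)}(\mathbf a;x)=\sum_H x^{\beta_1(H)}$, the sum over all $\mathbf a$-valid primitive subgraphs $H$ of $K_{n+1}$. *)

theory Defs
  imports "HOL-Analysis.Analysis" "HOL-Analysis.Finite_Function_Topology"
begin

(* The directed graph K_{n+1}; the vertex v_i is the number i. *)

definition K_edges :: "nat \<Rightarrow> (nat \<times> nat) set"
  where "K_edges n = {(i, j). 1 \<le> i \<and> i < j \<and> j \<le> n + 1}"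

(* R^{E(K_{n+1})} is realised as the subspace of the real vector space of finitely supported
   functions on nat \<times> nat that consists of the functions vanishing off K_edges n. A single
   ambient type thus serves all n, and the library notion face_of applies. A vector
   (a_1, ..., a_n) is a list of length n, so a_i is a ! (i - 1). *)

definition Flow :: "nat \<Rightarrow> nat list \<Rightarrow> ((nat \<times> nat) \<Rightarrow>\<^sub>0 real) set"
  where "Flow n a =
    {f. Poly_Mapping.keys f \<subseteq> K_edges n \<and>
        (\<forall>e\<in>K_edges n. 0 \<le> Poly_Mapping.lookup f e) \<and>
        (\<forall>i\<in>{1..n}. (\<Sum>j\<in>{i<..n+1}. Poly_Mapping.lookup f (i, j))
                    - (\<Sum>k\<in>{1..<i}. Poly_Mapping.lookup f (k, i)) = real (a ! (i - 1)))}"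

(* The library's aff_dim is restricted to Euclidean spaces, which the ambient space is not.
   The two agree where both are defined: see affine_dim_eq_aff_dim. *)

definition affine_dim :: "'a::real_vector set \<Rightarrow> int"
  where "affine_dim S = (if S = {} then -1 else int (dim {x - y | x y. x \<in> S \<and> y \<in> S}))"

lemma affine_dim_eq_aff_dim:
  fixes S :: "'a::euclidean_space set"
  shows "affine_dim S = aff_dim S"
proof (cases "S = {}")
  case True
  then show ?thesis by (simp add: affine_dim_def)
next
  case False
  then obtain c where c: "c \<in> S" by blast
  let ?D = "{x - y | x y. x \<in> S \<and> y \<in> S}" and ?T = "(\<lambda>x. x - c) ` S"
  have "?T \<subseteq> ?D" using c by blast
  moreover have "?D \<subseteq> span ?T"
  proof
    fix z assume "z \<in> ?D"
    then obtain x y where xy: "x \<in> S" "y \<in> S" and z: "z = x - y" by blast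
    have "(x - c) - (y - c) \<in> span ?T"
      using xy by (intro span_diff span_base imageI)
    then show "z \<in> span ?T" by (simp add: z)
  qed
  ultimately have "span ?D = span ?T"
    by (meson span_eq span_superset subset_trans)
  then have "dim ?D = dim ?T" by (rule span_eq_dim)
  moreover have "aff_dim S = int (dim ?T)"
    using c by (simp add: aff_dim_eq_dim_subtract hull_inc)
  ultimately show ?thesis using False by (simp add: affine_dim_def)
qed

(* Laurent polynomials in x are elements of the group ring of int, i.e. of the ring
   int \<Rightarrow>\<^sub>0 int; Poly_Mapping.single d c is c x^d. *)

type_synonym laurent = "int \<Rightarrow>\<^sub>0 int"

definition face_count :: "'a::real_vector set \<Rightarrow> int \<Rightarrow> nat"
  where "face_count P d = card {F. F face_of P \<and> affine_dim F = d}"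

(* Every face lies in R^{E(K_{n+1})}, so its dimension is at most card (K_edges n), and the
   finite range omits no face: see lookup_f_poly. *)

definition f_poly :: "nat \<Rightarrow> nat list \<Rightarrow> laurent"
  where "f_poly n a =
    (\<Sum>d\<in>{-1..int (card (K_edges n))}. Poly_Mapping.single d (int (face_count (Flow n a) d)))"

lemma finite_K_edges: "finite (K_edges n)"
  by (rule finite_subset[of _ "{..n+1} \<times> {..n+1}"]) (auto simp: K_edges_def)

lemma lookup_scaleR_poly_mapping:
  fixes f :: "'a \<Rightarrow>\<^sub>0 real"
  shows "Poly_Mapping.lookup (c *\<^sub>R f) e = c * Poly_Mapping.lookup f e"
proof -
  have "finite {i. c * Poly_Mapping.lookup f i \<noteq> 0}"
    by (rule finite_subset[OF _ finite_lookup[of f]]) auto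
  then show ?thesis by (simp add: scaleR_poly_mapping_def Abs_poly_mapping_inverse)
qed

lemma affine_dim_Flow_subset:
  assumes "F \<subseteq> Flow n a"
  shows "affine_dim F \<le> int (card (K_edges n))"
proof (cases "F = {}")
  case False
  let ?D = "{x - y | x y. x \<in> F \<and> y \<in> F}"
  let ?B = "(\<lambda>e. Poly_Mapping.single e (1::real)) ` K_edges n"
  have "?D \<subseteq> span ?B"
  proof
    fix z assume "z \<in> ?D"
    then obtain x y where xy: "x \<in> F" "y \<in> F" and z: "z = x - y" by blast
    have off: "Poly_Mapping.lookup z e = 0" if "e \<notin> K_edges n" for e
    proof -
      have "e \<notin> Poly_Mapping.keys x" "e \<notin> Poly_Mapping.keys y"
        using that xy assms unfolding Flow_def by blast+
      then show ?thesis by (simp add: z lookup_minus in_keys_iff)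
    qed
    have "z = (\<Sum>e\<in>K_edges n. Poly_Mapping.lookup z e *\<^sub>R Poly_Mapping.single e (1::real))"
    proof (rule poly_mapping_eqI)
      fix e
      have "(\<Sum>e'\<in>K_edges n. Poly_Mapping.lookup z e'
              * Poly_Mapping.lookup (Poly_Mapping.single e' (1::real)) e)
            = (\<Sum>e'\<in>K_edges n. if e' = e then Poly_Mapping.lookup z e' else 0)"
        by (rule sum.cong) (simp_all add: lookup_single when_def)
      also have "\<dots> = Poly_Mapping.lookup z e"
        using off by (simp add: finite_K_edges)
      finally show "Poly_Mapping.lookup z e = Poly_Mapping.lookup
          (\<Sum>e\<in>K_edges n. Poly_Mapping.lookup z e *\<^sub>R Poly_Mapping.single e (1::real)) e"
        by (simp add: lookup_sum lookup_scaleR_poly_mapping)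
    qed
    moreover have "\<dots> \<in> span ?B"
      by (intro span_sum span_scale span_base) auto
    ultimately show "z \<in> span ?B" by simp
  qed
  then have "dim ?D \<le> card ?B"
    using finite_K_edges by (intro dim_le_card) auto
  also have "\<dots> \<le> card (K_edges n)" by (rule card_image_le[OF finite_K_edges])
  finally show ?thesis using False by (simp add: affine_dim_def)
qed (simp add: affine_dim_def)

lemma lookup_f_poly: "Poly_Mapping.lookup (f_poly n a) d = int (face_count (Flow n a) d)"
proof (cases "d \<in> {-1..int (card (K_edges n))}")
  case True
  then show ?thesis
    by (simp add: f_poly_def lookup_sum lookup_single when_def)
next
  case False
  have ge: "-1 \<le> affine_dim F" for F :: "((nat \<times> nat) \<Rightarrow>\<^sub>0 real) set" by (simp add: affine_dim_def)
  have "affine_dim F \<noteq> d" if "F face_of Flow n a" for F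
    using False ge[of F] affine_dim_Flow_subset[OF face_of_imp_subset[OF that]] by auto
  then have "{F. F face_of Flow n a \<and> affine_dim F = d} = {}" by blast
  then have "face_count (Flow n a) d = 0"
    unfolding face_count_def by (simp only: card.empty)
  with False show ?thesis
    by (auto simp: f_poly_def lookup_sum lookup_single when_def intro!: sum.neutral)
qed

(* A subgraph without isolated vertices is given by its edge set. *)

definition valid :: "nat \<Rightarrow> nat list \<Rightarrow> (nat \<times> nat) set \<Rightarrow> bool"
  where "valid n a H \<longleftrightarrow> (\<exists>f\<in>Flow n a. H = {e. 0 < Poly_Mapping.lookup f e})"

definition verts :: "(nat \<times> nat) set \<Rightarrow> nat set"
  where "verts H = fst ` H \<union> snd ` H"

definition components :: "(nat \<times> nat) set \<Rightarrow> nat set set"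
  where "components H = verts H // (H \<union> H\<inverse>)\<^sup>*"

definition primitive :: "nat \<Rightarrow> (nat \<times> nat) set \<Rightarrow> bool"
  where "primitive n H \<longleftrightarrow>
    (\<forall>u\<in>verts H. \<forall>v\<in>verts H. (u, v) \<in> (H \<union> H\<inverse>)\<^sup>*) \<and> verts H = {1..n+1}"

definition betti :: "(nat \<times> nat) set \<Rightarrow> int"
  where "betti H = int (card H) - int (card (verts H)) + int (card (components H))"

definition prim_f_poly :: "nat \<Rightarrow> nat list \<Rightarrow> laurent"
  where "prim_f_poly n a = (\<Sum>H\<in>{H. valid n a H \<and> primitive n H}. Poly_Mapping.single (betti H) 1)"

(* Subsets of the zero entries are sets of (0-based) positions; nths a (- Z) is a with the
   entries at the positions in Z deleted. *)

definition zero_positions :: "nat list \<Rightarrow> nat set"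
  where "zero_positions a = {i. i < length a \<and> a ! i = 0}"

definition del_le :: "nat list \<Rightarrow> nat list \<Rightarrow> bool"  (infix "\<le>\<^sub>c" 50)
  where "b \<le>\<^sub>c a \<longleftrightarrow> (\<exists>Z\<subseteq>zero_positions a. b = nths a (- Z))"

definition del_mult :: "nat list \<Rightarrow> nat list \<Rightarrow> nat"
  where "del_mult a b = card {Z. Z \<subseteq> zero_positions a \<and> nths a (- Z) = b}"

end

theory Submission
  imports Defs
begin

text \<open>
  A nonempty face consists of the flows supported in the support \<open>H\<close> of one of its relative
  interior points, so the nonempty faces correspond to the valid subgraphs. Every vertex of a
  valid \<open>H\<close> reaches the sink along \<open>H\<close>, so \<open>H\<close> is connected; the direction space of its face
  is the space of circulations on \<open>H\<close>, of dimension \<open>\<beta>\<^sub>1(H)\<close>. The vertices missed by \<open>H\<close> carry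
  zero entries of \<open>a\<close>, and an order-preserving relabelling of the remaining vertices turns \<open>H\<close>
  into a primitive valid subgraph for the vector with these entries deleted.
\<close>

section \<open>Net outflow and valid subgraphs\<close>

text \<open>Taken for functions of arbitrary sign, so that it is linear in \<open>f\<close> and
  applies to differences of flows.\<close>

definition net :: "nat \<Rightarrow> ((nat \<times> nat) \<Rightarrow>\<^sub>0 real) \<Rightarrow> nat \<Rightarrow> real"
  where "net n f i = (\<Sum>j\<in>{i<..n+1}. Poly_Mapping.lookup f (i, j))
                    - (\<Sum>k\<in>{1..<i}. Poly_Mapping.lookup f (k, i))"

lemma net_add: "net n (f + g) i = net n f i + net n g i"
  by (simp add: net_def lookup_add sum.distrib)

lemma net_diff: "net n (f - g) i = net n f i - net n g i"
  by (simp add: net_def lookup_minus sum_subtractf)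

lemma net_scaleR: "net n (c *\<^sub>R f) i = c * net n f i"
  by (simp add: net_def lookup_scaleR_poly_mapping sum_distrib_left right_diff_distrib)

lemma net_zero [simp]: "net n 0 i = 0"
  by (simp add: net_def)

text \<open>Terms off the support vanish, so the index ranges can shrink to the edges of
  \<open>H\<close>. In this form the ambient \<open>n\<close> no longer appears in the sums, which
  is what relabelling the vertices requires.\<close>

lemma net_eq_incident_sums:
  assumes "Poly_Mapping.keys f \<subseteq> H" "H \<subseteq> K_edges n" "i \<in> {1..n}"
  shows "net n f i = (\<Sum>e\<in>{e\<in>H. fst e = i}. Poly_Mapping.lookup f e)
                    - (\<Sum>e\<in>{e\<in>H. snd e = i}. Poly_Mapping.lookup f e)"
proof -
  have "(\<Sum>j\<in>{i<..n+1}. Poly_Mapping.lookup f (i, j))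
      = (\<Sum>e\<in>Pair i ` {i<..n+1}. Poly_Mapping.lookup f e)"
    by (subst sum.reindex) (auto simp: inj_on_def)
  also have "\<dots> = (\<Sum>e\<in>{e\<in>H. fst e = i}. Poly_Mapping.lookup f e)"
    using assms by (intro sum.mono_neutral_right) (auto simp: K_edges_def in_keys_iff image_def)
  moreover have "(\<Sum>k\<in>{1..<i}. Poly_Mapping.lookup f (k, i))
      = (\<Sum>e\<in>(\<lambda>k. (k, i)) ` {1..<i}. Poly_Mapping.lookup f e)"
    by (subst sum.reindex) (auto simp: inj_on_def)
  moreover have "\<dots> = (\<Sum>e\<in>{e\<in>H. snd e = i}. Poly_Mapping.lookup f e)"
    using assms by (intro sum.mono_neutral_right) (auto simp: K_edges_def in_keys_iff image_def)
  ultimately show ?thesis by (simp add: net_def)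
qed

lemma net_single:
  assumes "(u, v) \<in> K_edges n" "i \<in> {1..n}"
  shows "net n (Poly_Mapping.single (u, v) c) i = (c when i = u) - (c when i = v)"
proof -
  have *: "{e \<in> {(u, v)}. fst e = i} = (if i = u then {(u, v)} else {})"
          "{e \<in> {(u, v)}. snd e = i} = (if i = v then {(u, v)} else {})" by auto
  have "net n (Poly_Mapping.single (u, v) c) i
      = (\<Sum>e\<in>{e \<in> {(u, v)}. fst e = i}. Poly_Mapping.lookup (Poly_Mapping.single (u, v) c) e)
      - (\<Sum>e\<in>{e \<in> {(u, v)}. snd e = i}. Poly_Mapping.lookup (Poly_Mapping.single (u, v) c) e)"
    using assms by (intro net_eq_incident_sums) auto
  then show ?thesis unfolding * by (simp add: when_def)
qed

text \<open>Off \<open>K_edges n\<close> the function is zero, so nonnegativity can be asked at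
  every pair without a side condition.\<close>

lemma Flow_iff:
  "f \<in> Flow n a \<longleftrightarrow> Poly_Mapping.keys f \<subseteq> K_edges n \<and> (\<forall>e. 0 \<le> Poly_Mapping.lookup f e)
     \<and> (\<forall>i\<in>{1..n}. net n f i = real (a ! (i - 1)))"
proof -
  have "(\<forall>e\<in>K_edges n. 0 \<le> Poly_Mapping.lookup f e) \<longleftrightarrow> (\<forall>e. 0 \<le> Poly_Mapping.lookup f e)"
    if "Poly_Mapping.keys f \<subseteq> K_edges n"
    using that by (metis in_keys_iff order_refl subsetD)
  then show ?thesis by (auto simp: Flow_def net_def)
qed

lemma keys_Flow:
  assumes "f \<in> Flow n a"
  shows "{e. 0 < Poly_Mapping.lookup f e} = Poly_Mapping.keys f"
  using assms by (auto simp: Flow_iff in_keys_iff less_le)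

lemma valid_iff_keys: "valid n a H \<longleftrightarrow> (\<exists>f\<in>Flow n a. Poly_Mapping.keys f = H)"
  unfolding valid_def using keys_Flow by blast

lemma valid_subset: "valid n a H \<Longrightarrow> H \<subseteq> K_edges n"
  by (auto simp: valid_iff_keys Flow_iff)

lemma finite_valid: "finite {H. valid n a H}"
  by (rule finite_subset[of _ "Pow (K_edges n)"]) (use valid_subset finite_K_edges in auto)

text \<open>Only the values on \<open>H\<close> matter, since extension by zero recovers a flow. The
  witness is an ordinary function, which is easy to transport along a relabelling.\<close>

lemma valid_iff:
  "valid n a H \<longleftrightarrow> H \<subseteq> K_edges n \<and> (\<exists>f. (\<forall>e\<in>H. 0 < f e) \<and>
     (\<forall>i\<in>{1..n}. (\<Sum>e\<in>{e\<in>H. fst e = i}. f e) - (\<Sum>e\<in>{e\<in>H. snd e = i}. f e)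
        = real (a ! (i - 1))))" (is "_ \<longleftrightarrow> ?R")
proof
  assume "valid n a H"
  then obtain f where f: "f \<in> Flow n a" "Poly_Mapping.keys f = H" by (auto simp: valid_iff_keys)
  moreover have "\<forall>e\<in>H. 0 < Poly_Mapping.lookup f e" using keys_Flow[OF f(1)] f(2) by auto
  ultimately show ?R
    using net_eq_incident_sums[of f H n] by (auto simp: Flow_iff intro!: exI[of _ "Poly_Mapping.lookup f"])
next
  assume ?R
  then obtain f where H: "H \<subseteq> K_edges n" and pos: "\<forall>e\<in>H. 0 < f e" and
    f: "\<forall>i\<in>{1..n}. (\<Sum>e\<in>{e\<in>H. fst e = i}. f e) - (\<Sum>e\<in>{e\<in>H. snd e = i}. f e)
        = real (a ! (i - 1))" by blast
  define g where "g = Abs_poly_mapping (\<lambda>e. if e \<in> H then f e else 0)"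
  have fin: "finite H" using H finite_K_edges finite_subset by blast
  have g: "Poly_Mapping.lookup g e = (if e \<in> H then f e else 0)" for e
    unfolding g_def by (subst Abs_poly_mapping_inverse) (auto intro: finite_subset[OF _ fin])
  have keys: "Poly_Mapping.keys g = H" using pos by (auto simp: in_keys_iff g split: if_splits)
  have "net n g i = real (a ! (i - 1))" if "i \<in> {1..n}" for i
    using f that keys H by (subst net_eq_incident_sums[of g H]) (auto simp: g)
  then have "g \<in> Flow n a"
    using pos H keys by (auto simp: Flow_iff g less_imp_le)
  then show "valid n a H" using keys valid_iff_keys by blast
qed

section \<open>Connectedness of valid subgraphs\<close>

lemma verts_subset: "H \<subseteq> K_edges n \<Longrightarrow> verts H \<subseteq> {1..n+1}"
  by (fastforce simp: verts_def K_edges_def)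

lemma finite_verts: "H \<subseteq> K_edges n \<Longrightarrow> finite (verts H)"
  by (rule finite_subset[OF verts_subset]) auto

text \<open>A vertex that is not the sink and has only incoming edges would have strictly negative
  net outflow, while the entries of \<open>a\<close> are nonnegative.\<close>

lemma valid_out_edge:
  assumes "valid n a H" "v \<in> verts H" "v \<noteq> n + 1"
  obtains w where "(v, w) \<in> H"
proof (rule ccontr)
  assume "\<not> thesis"
  then have no: "{e\<in>H. fst e = v} = {}" using that by auto
  obtain f where H: "H \<subseteq> K_edges n" and pos: "\<forall>e\<in>H. 0 < f e" and
    f: "\<forall>i\<in>{1..n}. (\<Sum>e\<in>{e\<in>H. fst e = i}. f e) - (\<Sum>e\<in>{e\<in>H. snd e = i}. f e)
        = real (a ! (i - 1))" using assms(1) unfolding valid_iff by blast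
  have v: "v \<in> {1..n}" using verts_subset[OF H] assms(2,3) by auto
  have fin: "finite H" using H finite_K_edges finite_subset by blast
  have "{e\<in>H. snd e = v} \<noteq> {}" using assms(2) no by (auto simp: verts_def)
  then have "0 < (\<Sum>e\<in>{e\<in>H. snd e = v}. f e)"
    using pos fin by (intro sum_pos) auto
  moreover have "- (\<Sum>e\<in>{e\<in>H. snd e = v}. f e) = real (a ! (v - 1))"
    using bspec[OF f v] by (simp only: no) simp
  ultimately show False by (smt (verit) of_nat_0_le_iff)
qed

text \<open>Follow out-edges: the vertex numbers increase along edges of \<open>K_edges n\<close>,
  so the walk can stop only at the sink. Hence the induction on the distance
  \<open>n + 1 - v\<close>.\<close>

lemma valid_reaches_sink:
  assumes "valid n a H" "v \<in> verts H"
  shows "(v, n + 1) \<in> H\<^sup>*"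
  using assms(2)
proof (induction "n + 1 - v" arbitrary: v rule: less_induct)
  case less
  show ?case
  proof (cases "v = n + 1")
    case False
    then obtain w where w: "(v, w) \<in> H" using valid_out_edge[OF assms(1) less.prems] by blast
    then have "v < w" "w \<le> n + 1" using valid_subset[OF assms(1)] by (auto simp: K_edges_def)
    moreover have "w \<in> verts H" using w by (force simp: verts_def)
    ultimately have "(w, n + 1) \<in> H\<^sup>*" by (intro less.hyps) auto
    with w show ?thesis by (rule converse_rtrancl_into_rtrancl)
  qed simp
qed

lemma sym_undirected_reach: "(u, v) \<in> (H \<union> H\<inverse>)\<^sup>* \<Longrightarrow> (v, u) \<in> (H \<union> H\<inverse>)\<^sup>*"
  by (metis converse_Un converse_converse rtrancl_converseI sup_commute)

text \<open>Any two vertices meet at the sink. For valid subgraphs, being primitive thus amounts to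
  having all of \<open>{1..n+1}\<close> as vertex set.\<close>

lemma valid_connected:
  assumes "valid n a H" "u \<in> verts H" "v \<in> verts H"
  shows "(u, v) \<in> (H \<union> H\<inverse>)\<^sup>*"
proof -
  have "(u, n + 1) \<in> (H \<union> H\<inverse>)\<^sup>*" "(v, n + 1) \<in> (H \<union> H\<inverse>)\<^sup>*"
    using valid_reaches_sink[OF assms(1)] assms(2,3) in_rtrancl_UnI by fast+
  then show ?thesis by (meson sym_undirected_reach rtrancl_trans)
qed

lemma card_components_connected:
  assumes "\<And>u v. u \<in> verts H \<Longrightarrow> v \<in> verts H \<Longrightarrow> (u, v) \<in> (H \<union> H\<inverse>)\<^sup>*" "verts H \<noteq> {}"
  shows "card (components H) = 1"
proof -
  obtain u where u: "u \<in> verts H" using assms(2) by blast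
  have "(H \<union> H\<inverse>)\<^sup>* `` {v} = (H \<union> H\<inverse>)\<^sup>* `` {u}" if "v \<in> verts H" for v
  proof -
    have "(u, v) \<in> (H \<union> H\<inverse>)\<^sup>*" "(v, u) \<in> (H \<union> H\<inverse>)\<^sup>*" using assms(1) u that by auto
    then show ?thesis by (auto intro: rtrancl_trans)
  qed
  then have "components H = {(H \<union> H\<inverse>)\<^sup>* `` {u}}"
    using u unfolding components_def quotient_def by blast
  then show ?thesis by simp
qed

text \<open>At a vertex missed by \<open>H\<close> both incident sums are empty, so its net outflow
  is 0. In other words, missed vertices carry zero entries.\<close>

lemma valid_support_vertex:
  assumes "valid n a H" "i \<in> {1..n}" "a ! (i - 1) \<noteq> 0"
  shows "i \<in> verts H"
proof (rule ccontr)
  assume "i \<notin> verts H"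
  then have no: "{e\<in>H. fst e = i} = {}" "{e\<in>H. snd e = i} = {}" by (auto simp: verts_def image_iff)
  obtain f where "(\<Sum>e\<in>{e\<in>H. fst e = i}. f e) - (\<Sum>e\<in>{e\<in>H. snd e = i}. f e) = real (a ! (i - 1))"
    using assms unfolding valid_iff by blast
  then show False unfolding no using assms(3) by simp
qed

text \<open>This is where the nonzero first entry enters: it forces vertex 1 into \<open>H\<close>,
  and vertex 1 reaches the sink. In particular \<open>H\<close> is nonempty.\<close>

lemma sink_in_verts:
  assumes "valid n a H" "n \<ge> 1" "a ! 0 \<noteq> 0"
  shows "n + 1 \<in> verts H"
proof -
  have "1 \<in> verts H" using valid_support_vertex[OF assms(1), of 1] assms(2,3) by simp
  then have "(1, n + 1) \<in> H\<^sup>*" by (rule valid_reaches_sink[OF assms(1)])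
  \<comment> \<open>As \<open>n \<ge> 1\<close>, the vertices \<open>1\<close> and
    \<open>n + 1\<close> differ, so the path has a last edge.\<close>
  then obtain k where "(k, n + 1) \<in> H" using assms(2) by (auto elim: rtranclE)
  then show ?thesis by (force simp: verts_def)
qed

lemma betti_valid:
  assumes "valid n a H" "n \<ge> 1" "a ! 0 \<noteq> 0"
  shows "betti H = int (card H) - int (card (verts H)) + 1"
  using card_components_connected[OF valid_connected[OF assms(1)]] sink_in_verts[OF assms]
  by (auto simp: betti_def)

lemma betti_primitive:
  assumes "primitive n H"
  shows "betti H = int (card H) - int (card (verts H)) + 1"
  using card_components_connected[of H] assms by (auto simp: betti_def primitive_def)

section \<open>Faces of the flow polytope\<close>

text \<open>The intersection of the polytope with the coordinate hyperplanes of the edges outside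
  \<open>H\<close>.\<close>

definition flow_face :: "nat \<Rightarrow> nat list \<Rightarrow> (nat \<times> nat) set \<Rightarrow> ((nat \<times> nat) \<Rightarrow>\<^sub>0 real) set"
  where "flow_face n a H = {g \<in> Flow n a. Poly_Mapping.keys g \<subseteq> H}"

lemma lookup_segment:
  "Poly_Mapping.lookup (u *\<^sub>R f + v *\<^sub>R g) e = u * Poly_Mapping.lookup f e + v * Poly_Mapping.lookup g e"
  for f g :: "'a \<Rightarrow>\<^sub>0 real"
  by (simp add: lookup_add lookup_scaleR_poly_mapping)

text \<open>Nonnegative coordinates with positive weights cannot cancel. This turns statements about
  segments into statements about unions of supports.\<close>

lemma keys_segment:
  assumes "f \<in> Flow n a" "g \<in> Flow n a" "0 < u" "0 < v"
  shows "Poly_Mapping.keys (u *\<^sub>R f + v *\<^sub>R g) = Poly_Mapping.keys f \<union> Poly_Mapping.keys g"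
proof -
  have "u * Poly_Mapping.lookup f e + v * Poly_Mapping.lookup g e = 0 \<longleftrightarrow>
        Poly_Mapping.lookup f e = 0 \<and> Poly_Mapping.lookup g e = 0" for e
  proof (subst add_nonneg_eq_0_iff)
    have "0 \<le> Poly_Mapping.lookup f e" "0 \<le> Poly_Mapping.lookup g e"
      using assms(1,2) unfolding Flow_iff by blast+
    then show "0 \<le> u * Poly_Mapping.lookup f e" "0 \<le> v * Poly_Mapping.lookup g e"
      using assms(3,4) by simp_all
  qed (use assms in simp)
  then show ?thesis by (auto simp: in_keys_iff lookup_segment)
qed

lemma keys_segment_subset:
  fixes f g :: "'a \<Rightarrow>\<^sub>0 real"
  shows "Poly_Mapping.keys (u *\<^sub>R f + v *\<^sub>R g) \<subseteq> Poly_Mapping.keys f \<union> Poly_Mapping.keys g"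
  by (auto simp: in_keys_iff lookup_segment)

lemma convex_Flow: "convex (Flow n a)"
proof (rule convexI)
  fix f g :: "(nat \<times> nat) \<Rightarrow>\<^sub>0 real" and u v :: real
  assume fg: "f \<in> Flow n a" "g \<in> Flow n a" and uv: "0 \<le> u" "0 \<le> v" "u + v = 1"
  have "Poly_Mapping.keys (u *\<^sub>R f + v *\<^sub>R g) \<subseteq> K_edges n"
    using keys_segment_subset[of u f v g] fg by (auto simp: Flow_iff)
  moreover have "u * c + v * c = c" for c using uv(3) by (metis distrib_right mult_1)
  ultimately show "u *\<^sub>R f + v *\<^sub>R g \<in> Flow n a"
    using fg uv by (auto simp: Flow_iff lookup_segment net_add net_scaleR)
qed

lemma convex_flow_face: "convex (flow_face n a H)"
proof (rule convexI)
  fix f g :: "(nat \<times> nat) \<Rightarrow>\<^sub>0 real" and u v :: real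
  assume fg: "f \<in> flow_face n a H" "g \<in> flow_face n a H" and uv: "0 \<le> u" "0 \<le> v" "u + v = 1"
  then show "u *\<^sub>R f + v *\<^sub>R g \<in> flow_face n a H"
    using keys_segment_subset[of u f v g] convexD[OF convex_Flow, of f n a g u v]
    by (auto simp: flow_face_def)
qed

text \<open>The support of an interior point of a segment is the union of the supports of the
  endpoints, so if it lies in \<open>H\<close>, both of them do.\<close>

lemma flow_face_face_of: "flow_face n a H face_of Flow n a"
proof (unfold face_of_def, intro conjI ballI impI)
  fix f g h assume fg: "f \<in> Flow n a" "g \<in> Flow n a" and h: "h \<in> flow_face n a H" "h \<in> open_segment f g"
  then obtain u where u: "0 < u" "u < 1" "h = (1 - u) *\<^sub>R f + u *\<^sub>R g"
    by (auto simp: in_segment)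
  then have "Poly_Mapping.keys h = Poly_Mapping.keys f \<union> Poly_Mapping.keys g"
    using keys_segment[OF fg, of "1 - u" u] by simp
  then show "f \<in> flow_face n a H" "g \<in> flow_face n a H"
    using fg h by (auto simp: flow_face_def)
qed (auto simp: convex_flow_face, auto simp: flow_face_def)

text \<open>The coordinates of \<open>f\<close> on its support are strictly positive and finite in
  number, so a small enough step along a circulation on that support keeps them nonnegative.\<close>

lemma Flow_perturb:
  assumes f: "f \<in> Flow n a" and z: "Poly_Mapping.keys z \<subseteq> Poly_Mapping.keys f" "\<forall>i\<in>{1..n}. net n z i = 0"
  obtains \<epsilon> where "0 < \<epsilon>" "f + \<epsilon> *\<^sub>R z \<in> Flow n a"
proof -
  let ?q = "\<lambda>e. Poly_Mapping.lookup f e / (\<bar>Poly_Mapping.lookup z e\<bar> + 1)"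
  \<comment> \<open>The \<open>+ 1\<close> in \<open>?q\<close> avoids division by zero where
    \<open>z\<close> vanishes, and the inserted \<open>1\<close> keeps \<open>Min\<close> meaningful
    when \<open>f\<close> has empty support.\<close>
  define \<epsilon> where "\<epsilon> = Min (insert 1 (?q ` Poly_Mapping.keys f))"
  have pos: "0 < Poly_Mapping.lookup f e" if "e \<in> Poly_Mapping.keys f" for e
    using keys_Flow[OF f] that by auto
  have "0 < \<epsilon>" unfolding \<epsilon>_def using pos by (subst Min_gr_iff) (auto intro!: divide_pos_pos)
  have "0 \<le> Poly_Mapping.lookup f e + \<epsilon> * Poly_Mapping.lookup z e" for e
  proof (cases "e \<in> Poly_Mapping.keys f")
    case True
    then have "\<epsilon> \<le> ?q e" unfolding \<epsilon>_def by (intro Min_le) auto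
    then have "\<epsilon> * (\<bar>Poly_Mapping.lookup z e\<bar> + 1) \<le> Poly_Mapping.lookup f e"
      by (simp add: pos_le_divide_eq)
    moreover have "\<epsilon> * - Poly_Mapping.lookup z e \<le> \<epsilon> * (\<bar>Poly_Mapping.lookup z e\<bar> + 1)"
      using \<open>0 < \<epsilon>\<close> by (intro mult_left_mono) auto
    ultimately show ?thesis by simp
  next
    case False
    then have "e \<notin> Poly_Mapping.keys z" using z by blast
    then show ?thesis using False by (simp add: in_keys_iff)
  qed
  moreover have "Poly_Mapping.keys (f + \<epsilon> *\<^sub>R z) \<subseteq> K_edges n"
    using keys_segment_subset[of 1 f \<epsilon> z] z f by (auto simp: Flow_iff)
  ultimately have "f + \<epsilon> *\<^sub>R z \<in> Flow n a"
    using f z by (auto simp: Flow_iff lookup_add lookup_scaleR_poly_mapping net_add net_scaleR)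
  with \<open>0 < \<epsilon>\<close> show thesis by (rule that)
qed

text \<open>A point \<open>f\<close> of \<open>F\<close> with the largest support plays the role of
  a relative interior point; its support is the required \<open>H\<close>.\<close>

lemma face_of_Flow_obtain:
  assumes F: "F face_of Flow n a" "F \<noteq> {}"
  obtains H where "valid n a H" "F = flow_face n a H"
proof -
  have sub: "F \<subseteq> Flow n a" using F face_of_imp_subset by blast
  have "card (Poly_Mapping.keys f) \<le> card (K_edges n)" if "f \<in> F" for f
  proof -
    have "f \<in> Flow n a" using that sub by blast
    then show ?thesis by (intro card_mono[OF finite_K_edges]) (simp add: Flow_iff)
  qed
  then obtain f where f: "f \<in> F"
    and max: "\<And>g. g \<in> F \<Longrightarrow> card (Poly_Mapping.keys g) \<le> card (Poly_Mapping.keys f)"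
    using ex_has_greatest_nat[of "\<lambda>f. f \<in> F" _ "\<lambda>f. card (Poly_Mapping.keys f)" "card (K_edges n) + 1"] F(2)
    by (metis ex_in_conv less_Suc_eq_le Suc_eq_plus1)
  have fF: "f \<in> Flow n a" using f sub by blast
  let ?H = "Poly_Mapping.keys f"
  have "g \<in> flow_face n a ?H" if g: "g \<in> F" for g
  proof -
    have gF: "g \<in> Flow n a" using g sub by blast
    \<comment> \<open>The midpoint stays in \<open>F\<close> by convexity and has the union of both
      supports as its support; maximality of \<open>f\<close> then puts the support of
      \<open>g\<close> inside \<open>?H\<close>.\<close>
    let ?m = "(1/2) *\<^sub>R f + (1/2) *\<^sub>R g"
    have "?m \<in> F" using face_of_imp_convex[OF F(1)] f g by (intro convexD) auto
    then have "card (?H \<union> Poly_Mapping.keys g) \<le> card ?H"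
      using max keys_segment[OF fF gF, of "1/2" "1/2"] by fastforce
    then have "?H = ?H \<union> Poly_Mapping.keys g"
      by (intro card_seteq) auto
    then show ?thesis using gF by (auto simp: flow_face_def)
  qed
  moreover have "g \<in> F" if "g \<in> flow_face n a ?H" for g
  proof (cases "g = f")
    case False
    have g: "g \<in> Flow n a" "Poly_Mapping.keys g \<subseteq> ?H" using that by (auto simp: flow_face_def)
    \<comment> \<open>The difference \<open>f - g\<close> is a circulation on \<open>?H\<close>, so
      the segment from \<open>g\<close> to \<open>f\<close> can be prolonged beyond \<open>f\<close>
      inside the polytope. The face property at \<open>f\<close> then yields
      \<open>g \<in> F\<close>.\<close>
    have "Poly_Mapping.keys (f - g) \<subseteq> ?H"
      using keys_segment_subset[of 1 f "-1" g] g by auto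
    moreover have "\<forall>i\<in>{1..n}. net n (f - g) i = 0"
      using fF g by (auto simp: Flow_iff net_diff)
    ultimately obtain \<epsilon> where e: "0 < \<epsilon>" "f + \<epsilon> *\<^sub>R (f - g) \<in> Flow n a"
      using Flow_perturb[OF fF] by blast
    \<comment> \<open>The weight \<open>?u\<close> solves \<open>(1 - u) g + u h = f\<close> for the
      prolonged endpoint \<open>?h\<close>.\<close>
    let ?h = "f + \<epsilon> *\<^sub>R (f - g)" and ?u = "1 / (1 + \<epsilon>)"
    have "(1 - ?u) *\<^sub>R g + ?u *\<^sub>R ?h = f"
    proof (rule poly_mapping_eqI)
      fix k show "Poly_Mapping.lookup ((1 - ?u) *\<^sub>R g + ?u *\<^sub>R ?h) k = Poly_Mapping.lookup f k"
        using e(1) by (simp add: lookup_add lookup_minus lookup_scaleR_poly_mapping divide_simps)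
          (simp add: algebra_simps)
    qed
    moreover have "g \<noteq> ?h"
    proof
      assume "g = ?h"
      then have "f - g + \<epsilon> *\<^sub>R (f - g) = 0" by (metis add_diff_eq diff_add_eq diff_self)
      then have "(1 + \<epsilon>) *\<^sub>R (f - g) = 0" by (simp add: scaleR_add_left)
      then show False using e(1) False by simp
    qed
    ultimately have "f \<in> open_segment g ?h"
      unfolding in_segment using e(1) by (intro conjI exI[of _ ?u]) (auto simp: divide_simps)
    then show ?thesis using F(1) g(1) e(2) f unfolding face_of_def by blast
  qed (use f in simp)
  moreover have "valid n a ?H" using fF valid_iff_keys by blast
  ultimately show thesis by (intro that[of ?H]) auto
qed

text \<open>For valid \<open>H\<close> some flow has support exactly \<open>H\<close>, so
  \<open>H\<close> is recovered as the union of all supports in its face.\<close>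

lemma flow_face_inj: "inj_on (flow_face n a) {H. valid n a H}"
proof (rule inj_onI)
  have "H = \<Union> (Poly_Mapping.keys ` flow_face n a H)" if "valid n a H" for H
    using that by (auto simp: valid_iff_keys flow_face_def)
  then show "H = H'" if "H \<in> {H. valid n a H}" "H' \<in> {H. valid n a H}" 
    "flow_face n a H = flow_face n a H'" for H H' using that by (metis mem_Collect_eq)
qed

lemma flow_face_nonempty: "valid n a H \<Longrightarrow> flow_face n a H \<noteq> {}"
  by (auto simp: valid_iff_keys flow_face_def)

lemma faces_of_Flow:
  "{F. F face_of Flow n a} = insert {} (flow_face n a ` {H. valid n a H})"
proof (intro equalityI subsetI)
  fix F assume F: "F \<in> {F. F face_of Flow n a}"
  show "F \<in> insert {} (flow_face n a ` {H. valid n a H})"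
  proof (cases "F = {}")
    case False
    then obtain H where "valid n a H" "F = flow_face n a H"
      using face_of_Flow_obtain F by blast
    then show ?thesis by simp
  qed simp
qed (use flow_face_face_of in auto)

section \<open>Dimension of a face\<close>

definition circulations :: "nat \<Rightarrow> (nat \<times> nat) set \<Rightarrow> ((nat \<times> nat) \<Rightarrow>\<^sub>0 real) set"
  where "circulations n H = {z. Poly_Mapping.keys z \<subseteq> H \<and> (\<forall>i\<in>{1..n}. net n z i = 0)}"

text \<open>Starting from a flow \<open>f\<close> with full support \<open>H\<close>, a small
  positive multiple of any circulation \<open>z\<close> is the difference of
  \<open>f + \<epsilon> z\<close> and \<open>f\<close>, both in the face.\<close>

lemma span_flow_face_differences:
  assumes "valid n a H"
  shows "span {x - y | x y. x \<in> flow_face n a H \<and> y \<in> flow_face n a H} = span (circulations n H)"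
    (is "span ?D = _")
proof -
  obtain f where f: "f \<in> Flow n a" "Poly_Mapping.keys f = H" using assms by (auto simp: valid_iff_keys)
  have "x - y \<in> circulations n H" if "x \<in> flow_face n a H" "y \<in> flow_face n a H" for x y
    using that keys_segment_subset[of 1 x "-1" y]
    by (auto simp: flow_face_def circulations_def Flow_iff net_diff)
  then have "?D \<subseteq> circulations n H" by blast
  moreover have "circulations n H \<subseteq> span ?D"
  proof
    fix z assume z: "z \<in> circulations n H"
    then obtain \<epsilon> where e: "0 < \<epsilon>" "f + \<epsilon> *\<^sub>R z \<in> Flow n a"
      using Flow_perturb[OF f(1), of z] f(2) by (auto simp: circulations_def)
    moreover have "Poly_Mapping.keys (f + \<epsilon> *\<^sub>R z) \<subseteq> H"
      using keys_segment_subset[of 1 f \<epsilon> z] z f(2) by (auto simp: circulations_def)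
    ultimately have "(f + \<epsilon> *\<^sub>R z) - f \<in> ?D" using f unfolding flow_face_def by blast
    then have "(1 / \<epsilon>) *\<^sub>R ((f + \<epsilon> *\<^sub>R z) - f) \<in> span ?D" by (intro span_scale span_base)
    then show "z \<in> span ?D" using e(1) by simp
  qed
  ultimately show ?thesis by (meson span_eq span_superset subset_trans)
qed

text \<open>
  Choosing one out-edge of \<open>H\<close> at each vertex other than the sink gives a spanning tree \<open>T\<close>; its
  fundamental circulations form a basis.
\<close>
lemma dim_circulations:
  assumes H: "H \<subseteq> K_edges n" and out: "\<And>v. v \<in> verts H \<Longrightarrow> v \<noteq> n + 1 \<Longrightarrow> \<exists>w. (v, w) \<in> H"
    and sink: "n + 1 \<in> verts H"
  shows "int (dim (circulations n H)) = int (card H) - int (card (verts H)) + 1"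
proof -
  obtain s where s: "\<And>v. v \<in> verts H \<Longrightarrow> v \<noteq> n + 1 \<Longrightarrow> (v, s v) \<in> H" using out by metis
  define W where "W = verts H - {n + 1}"
  define T where "T = (\<lambda>v. (v, s v)) ` W"
  have T: "T \<subseteq> H" using s by (auto simp: T_def W_def)
  have finH: "finite H" using H finite_K_edges finite_subset by blast
  have W: "W \<subseteq> {1..n}" using verts_subset[OF H] by (fastforce simp: W_def)
  \<comment> \<open>The unit flow from \<open>v\<close> to the sink along \<open>T\<close>. It is
    built edge by edge; at the sink the zero function serves, because nothing is required of the net
    outflow at \<open>n + 1\<close>.\<close>
  have path: "\<exists>p. Poly_Mapping.keys p \<subseteq> T \<and> (\<forall>i\<in>{1..n}. net n p i = (1 when i = v))"
    if "v \<in> verts H" for v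
    using that
  proof (induction "n + 1 - v" arbitrary: v rule: less_induct)
    case less
    show ?case
    proof (cases "v = n + 1")
      case True
      then show ?thesis by (intro exI[of _ 0]) auto
    next
      case False
      then have e: "(v, s v) \<in> H" using s less.prems by blast
      then have K: "(v, s v) \<in> K_edges n" using H by blast
      have "s v \<in> verts H" using e by (force simp: verts_def)
      moreover have "v < s v" "s v \<le> n + 1" using K by (auto simp: K_edges_def)
      ultimately obtain p where p: "Poly_Mapping.keys p \<subseteq> T" "\<forall>i\<in>{1..n}. net n p i = (1 when i = s v)"
        using less.hyps[of "s v"] less.prems by fastforce
      have "(v, s v) \<in> T" using less.prems False by (auto simp: T_def W_def)
      then have "Poly_Mapping.keys (Poly_Mapping.single (v, s v) 1 + p) \<subseteq> T"
        using p(1) keys_add[of "Poly_Mapping.single (v, s v) (1::real)" p] by auto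
      then show ?thesis using p(2) K
        by (intro exI[of _ "Poly_Mapping.single (v, s v) 1 + p"]) (auto simp: net_add net_single)
    qed
  qed
  \<comment> \<open>\<open>T\<close> carries no nonzero circulation: at the smallest tail
    \<open>v\<close> of the support, no edge of the support enters, since its tail would be smaller
    still, and \<open>(v, s v)\<close> is the only one leaving. The net outflow at \<open>v\<close>
    is then the nonzero value on that edge.\<close>
  have unique: "z = 0" if z: "z \<in> circulations n H" "Poly_Mapping.keys z \<subseteq> T" for z
  proof (rule ccontr)
    assume "z \<noteq> 0"
    define A where "A = fst ` Poly_Mapping.keys z"
    have "finite A" "A \<noteq> {}" using \<open>z \<noteq> 0\<close> by (auto simp: A_def)
    then have v: "Min A \<in> A" and min: "\<And>u. u \<in> A \<Longrightarrow> Min A \<le> u" by auto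
    define v where "v = Min A"
    obtain e where e: "e \<in> Poly_Mapping.keys z" "fst e = v" using v by (auto simp: A_def v_def)
    then have e': "e = (v, s v)" "v \<in> W" using z(2) by (auto simp: T_def)
    have "v \<in> {1..n}" using e' W by blast
    moreover have no_in: "{e \<in> Poly_Mapping.keys z. snd e = v} = {}"
    proof -
      have False if "(u, v) \<in> Poly_Mapping.keys z" for u
      proof -
        have "u < v" using that z(1) H by (auto simp: circulations_def K_edges_def)
        moreover have "v \<le> u" unfolding v_def using that by (intro min) (force simp: A_def)
        ultimately show False by simp
      qed
      then show ?thesis by auto
    qed
    moreover have only_out: "{e \<in> Poly_Mapping.keys z. fst e = v} = {(v, s v)}"
      using e e' z(2) by (auto simp: T_def)
    moreover have "Poly_Mapping.keys z \<subseteq> K_edges n" using z(1) H by (auto simp: circulations_def)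
    ultimately have "net n z v = Poly_Mapping.lookup z (v, s v)"
      by (subst net_eq_incident_sums[OF order_refl]) (simp_all only: no_in only_out, simp_all)
    then show False using z(1) \<open>v \<in> {1..n}\<close> e e' by (auto simp: circulations_def in_keys_iff)
  qed
  have "\<exists>b. b \<in> circulations n H \<and> (\<forall>e'\<in>H - T. Poly_Mapping.lookup b e' = (1 when e' = e))"
    if "e \<in> H - T" for e
  proof -
    obtain u v where e: "e = (u, v)" by force
    have "u \<in> verts H" "v \<in> verts H" using that e by (force simp: verts_def)+
    then obtain p q where p: "Poly_Mapping.keys p \<subseteq> T" "\<forall>i\<in>{1..n}. net n p i = (1 when i = u)"
      and q: "Poly_Mapping.keys q \<subseteq> T" "\<forall>i\<in>{1..n}. net n q i = (1 when i = v)"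
      using path by meson
    \<comment> \<open>The fundamental circulation of \<open>e\<close>: traverse \<open>e\<close>
      from \<open>u\<close> to \<open>v\<close>, go on to the sink along the tree, and return along
      the tree path of \<open>u\<close> reversed.\<close>
    define b where "b = Poly_Mapping.single e 1 + q - p"
    have off: "Poly_Mapping.lookup b e' = (1 when e' = e)" if "e' \<notin> T" for e'
    proof -
      have "e' \<notin> Poly_Mapping.keys p" "e' \<notin> Poly_Mapping.keys q" using that p q by auto
      then show ?thesis
        by (auto simp: b_def lookup_add lookup_minus lookup_single in_keys_iff when_def)
    qed
    have "Poly_Mapping.keys b \<subseteq> H"
    proof
      fix e' assume "e' \<in> Poly_Mapping.keys b"
      then show "e' \<in> H" using off[of e'] T \<open>e \<in> H - T\<close> by (cases "e' \<in> T") (auto simp: in_keys_iff)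
    qed
    moreover have "(u, v) \<in> K_edges n" using that e H by auto
    ultimately have "b \<in> circulations n H"
      using p(2) q(2) by (auto simp: circulations_def b_def net_add net_diff e net_single)
    then show ?thesis using off by blast
  qed
  then obtain b where b: "\<And>e. e \<in> H - T \<Longrightarrow> b e \<in> circulations n H"
    "\<And>e e'. e \<in> H - T \<Longrightarrow> e' \<in> H - T \<Longrightarrow> Poly_Mapping.lookup (b e) e' = (1 when e' = e)"
    by metis
  have inj: "inj_on b (H - T)"
  proof (rule inj_onI)
    fix e e' assume "e \<in> H - T" "e' \<in> H - T" "b e = b e'"
    then have "(1 when e = e) = (1 when e = e' :: real)" using b(2) by metis
    then show "e = e'" by (auto simp: when_def split: if_splits)
  qed
  \<comment> \<open>Off \<open>T\<close> the circulations \<open>b e\<close> behave like unit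
    vectors, so the coefficients of a combination can be read off there. This serves both
    independence and spanning.\<close>
  have coord: "Poly_Mapping.lookup (\<Sum>e\<in>H - T. c e *\<^sub>R b e) e' = c e'" if "e' \<in> H - T" for c e'
  proof -
    have "Poly_Mapping.lookup (\<Sum>e\<in>H - T. c e *\<^sub>R b e) e'
        = (\<Sum>e\<in>H - T. if e = e' then c e else 0)"
      unfolding lookup_sum
      by (rule sum.cong) (use that b(2) in \<open>auto simp: lookup_scaleR_poly_mapping when_def\<close>)
    also have "\<dots> = c e'" using that finH by simp
    finally show ?thesis .
  qed
  have sub: "subspace (circulations n H)"
  proof (rule subspaceI)
    show "0 \<in> circulations n H" by (simp add: circulations_def)
    show "x + y \<in> circulations n H" if "x \<in> circulations n H" "y \<in> circulations n H" for x y
      using that keys_add[of x y] by (auto simp: circulations_def net_add)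
    show "c *\<^sub>R x \<in> circulations n H" if "x \<in> circulations n H" for c x
      using that keys_segment_subset[of c x 0 x] by (auto simp: circulations_def net_scaleR)
  qed
  have "independent (b ` (H - T))"
  proof (rule independent_if_scalars_zero)
    fix c x assume 0: "(\<Sum>x\<in>b ` (H - T). c x *\<^sub>R x) = 0" and x: "x \<in> b ` (H - T)"
    then obtain e where e: "e \<in> H - T" "x = b e" by blast
    have "(\<Sum>e\<in>H - T. c (b e) *\<^sub>R b e) = 0" using 0 by (simp add: sum.reindex[OF inj])
    then show "c x = 0" using coord[OF e(1), of "\<lambda>e. c (b e)"] e(2) by simp
  qed (use finH in simp)
  moreover have "circulations n H \<subseteq> span (b ` (H - T))"
  proof
    fix z assume z: "z \<in> circulations n H"
    \<comment> \<open>The combination that agrees with \<open>z\<close> off \<open>T\<close>; the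
      difference is a circulation supported on \<open>T\<close>, hence zero.\<close>
    let ?y = "\<Sum>e\<in>H - T. Poly_Mapping.lookup z e *\<^sub>R b e"
    have "?y \<in> circulations n H" using b(1) by (intro subspace_sum[OF sub] subspace_scale[OF sub])
    then have d: "z - ?y \<in> circulations n H" by (rule subspace_diff[OF sub z])
    have "Poly_Mapping.keys (z - ?y) \<subseteq> T"
    proof
      fix e assume e: "e \<in> Poly_Mapping.keys (z - ?y)"
      then have "e \<in> H" using d by (auto simp: circulations_def)
      then show "e \<in> T" using e coord[of e "Poly_Mapping.lookup z"] by (auto simp: in_keys_iff lookup_minus)
    qed
    then have "z = ?y" using unique[OF d] by simp
    moreover have "?y \<in> span (b ` (H - T))" by (intro span_sum span_scale span_base) auto
    ultimately show "z \<in> span (b ` (H - T))" by simp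
  qed
  moreover have "b ` (H - T) \<subseteq> circulations n H" using b(1) by blast
  ultimately have "dim (circulations n H) = card (b ` (H - T))"
    by (intro dim_unique) auto
  also have "\<dots> = card H - card T" by (simp add: card_image[OF inj] card_Diff_subset[OF finite_subset[OF T finH] T])
  finally have "dim (circulations n H) = card H - card T" .
  moreover have "card T = card W" unfolding T_def by (rule card_image) (auto simp: inj_on_def)
  \<comment> \<open>The tree has one edge for each vertex other than the sink.\<close>
  moreover have "card W + 1 = card (verts H)"
    using sink finite_verts[OF H] unfolding W_def by (simp del: card_Diff_insert card_Diff_singleton add: card_Suc_Diff1)
  \<comment> \<open>Makes the subtraction of naturals exact when it is read in the integers.\<close>
  moreover have "card T \<le> card H" using T finH by (rule card_mono[rotated])
  ultimately show ?thesis by simp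
qed

lemma affine_dim_flow_face:
  assumes "valid n a H" "n \<ge> 1" "a ! 0 \<noteq> 0"
  shows "affine_dim (flow_face n a H) = betti H"
proof -
  have "int (dim (circulations n H)) = betti H"
    unfolding betti_valid[OF assms]
  proof (rule dim_circulations)
    show "\<exists>w. (v, w) \<in> H" if "v \<in> verts H" "v \<noteq> n + 1" for v
      using valid_out_edge[OF assms(1) that] by blast
  qed (rule valid_subset[OF assms(1)], rule sink_in_verts[OF assms])
  then show ?thesis
    using flow_face_nonempty[OF assms(1)]
    by (simp add: affine_dim_def span_eq_dim[OF span_flow_face_differences[OF assms(1)]])
qed

section \<open>The f-polynomial as a sum over valid subgraphs\<close>

text \<open>The coefficients count faces by dimension, so the polynomial is a sum over single faces.
  The empty face gives the term of exponent -1, and each other face is indexed by its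
  subgraph.\<close>

lemma f_poly_eq_sum_valid:
  assumes "n \<ge> 1" "a ! 0 \<noteq> 0"
  shows "f_poly n a = Poly_Mapping.single (-1) 1
           + (\<Sum>H\<in>{H. valid n a H}. Poly_Mapping.single (betti H) 1)"
proof -
  let ?F = "{F. F face_of Flow n a}"
  have fin: "finite ?F" unfolding faces_of_Flow using finite_valid by auto
  have "f_poly n a = (\<Sum>F\<in>?F. Poly_Mapping.single (affine_dim F) 1)"
  proof (rule poly_mapping_eqI)
    fix d
    have "Poly_Mapping.lookup (\<Sum>F\<in>?F. Poly_Mapping.single (affine_dim F) (1::int)) d
        = (\<Sum>F\<in>?F. if affine_dim F = d then 1 else 0)"
      by (simp add: lookup_sum lookup_single when_def eq_commute)
    also have "\<dots> = int (card {F \<in> ?F. affine_dim F = d})"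
      using fin by (subst sum.If_cases) (simp_all add: Int_def)
    finally show "Poly_Mapping.lookup (f_poly n a) d
        = Poly_Mapping.lookup (\<Sum>F\<in>?F. Poly_Mapping.single (affine_dim F) (1::int)) d"
      by (simp add: lookup_f_poly face_count_def)
  qed
  also have "\<dots> = Poly_Mapping.single (affine_dim ({} :: ((nat \<times> nat) \<Rightarrow>\<^sub>0 real) set)) 1
      + (\<Sum>F\<in>flow_face n a ` {H. valid n a H}. Poly_Mapping.single (affine_dim F) 1)"
    unfolding faces_of_Flow using finite_valid flow_face_nonempty[of n a]
    by (intro sum.insert) auto
  also have "\<dots> = Poly_Mapping.single (-1) 1
           + (\<Sum>H\<in>{H. valid n a H}. Poly_Mapping.single (betti H) 1)"
    unfolding sum.reindex[OF flow_face_inj] 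
    using affine_dim_flow_face[of n a] assms by (simp add: affine_dim_def[of "{}"])
  finally show ?thesis .
qed

section \<open>Relabelling vertices and deleting zero entries\<close>

text \<open>An increasing map that sends sink to sink carries edges to edges and incident sums to
  incident sums. The vertices it skips meet no edge of the image and have zero entries, so they
  impose no condition.\<close>

lemma valid_relabel:
  assumes \<phi>: "strict_mono_on {1..m+1} \<phi>" "\<phi> ` {1..m+1} \<subseteq> {1..n+1}" "\<phi> (m + 1) = n + 1"
    and ab: "\<And>i. i \<in> {1..m} \<Longrightarrow> a ! (\<phi> i - 1) = b ! (i - 1)"
    and zero: "\<And>j. j \<in> {1..n} - \<phi> ` {1..m} \<Longrightarrow> a ! (j - 1) = 0"
    and H: "H \<subseteq> K_edges m"
  shows "valid n a (map_prod \<phi> \<phi> ` H) \<longleftrightarrow> valid m b H"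
proof -
  let ?\<Phi> = "map_prod \<phi> \<phi>"
  have inj: "inj_on \<phi> {1..m+1}" using \<phi>(1) by (rule strict_mono_on_imp_inj_on)
  have HV: "H \<subseteq> {1..m+1} \<times> {1..m+1}" using H by (auto simp: K_edges_def)
  have injH: "inj_on ?\<Phi> H" using map_prod_inj_on[OF inj inj] HV by (rule inj_on_subset)
  have K: "?\<Phi> ` H \<subseteq> K_edges n"
  proof clarsimp
    fix i j assume "(i, j) \<in> H"
    then have ij: "1 \<le> i" "i < j" "j \<le> m + 1" using H by (auto simp: K_edges_def)
    then have "\<phi> i < \<phi> j" using \<phi>(1) by (auto intro: strict_mono_onD)
    moreover have "\<phi> i \<in> {1..n+1}" "\<phi> j \<in> {1..n+1}" using ij \<phi>(2) by (auto simp: image_subset_iff)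
    ultimately show "(\<phi> i, \<phi> j) \<in> K_edges n" by (auto simp: K_edges_def)
  qed
  \<comment> \<open>The extra point \<open>m + 1\<close> is sent to \<open>n + 1\<close>, which
    exceeds \<open>n\<close>.\<close>
  have img: "j \<in> \<phi> ` {1..m}" if "j \<in> \<phi> ` {1..m+1}" "j \<le> n" for j
    using that \<phi>(3) by (auto simp: le_Suc_eq)
  have im: "\<phi> i \<in> {1..n}" if "i \<in> {1..m}" for i
  proof -
    have "\<phi> i < \<phi> (m + 1)" using that \<phi>(1) by (auto intro: strict_mono_onD)
    moreover have "\<phi> i \<in> {1..n+1}" using that \<phi>(2) by (auto simp: image_subset_iff)
    ultimately show ?thesis using \<phi>(3) by auto
  qed
  have fst_sum: "(\<Sum>e\<in>{e\<in>?\<Phi> ` H. fst e = \<phi> i}. f e) = (\<Sum>e\<in>{e\<in>H. fst e = i}. f (?\<Phi> e))"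
    and snd_sum: "(\<Sum>e\<in>{e\<in>?\<Phi> ` H. snd e = \<phi> i}. f e) = (\<Sum>e\<in>{e\<in>H. snd e = i}. f (?\<Phi> e))"
    if "i \<in> {1..m}" for i and f :: "nat \<times> nat \<Rightarrow> real"
  proof -
    have eq: "\<phi> k = \<phi> i \<longleftrightarrow> k = i" if "k \<in> {1..m+1}" for k
      using inj_on_eq_iff[OF inj that, of i] \<open>i \<in> {1..m}\<close> by simp
    have "{e\<in>?\<Phi> ` H. fst e = \<phi> i} = ?\<Phi> ` {e\<in>H. fst e = i}"
      using HV eq by fastforce
    then show "(\<Sum>e\<in>{e\<in>?\<Phi> ` H. fst e = \<phi> i}. f e) = (\<Sum>e\<in>{e\<in>H. fst e = i}. f (?\<Phi> e))"
      by (simp add: sum.reindex[OF inj_on_subset[OF injH]])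
    have "{e\<in>?\<Phi> ` H. snd e = \<phi> i} = ?\<Phi> ` {e\<in>H. snd e = i}"
      using HV eq by fastforce
    then show "(\<Sum>e\<in>{e\<in>?\<Phi> ` H. snd e = \<phi> i}. f e) = (\<Sum>e\<in>{e\<in>H. snd e = i}. f (?\<Phi> e))"
      by (simp add: sum.reindex[OF inj_on_subset[OF injH]])
  qed
  have cons: "(\<forall>j\<in>{1..n}. (\<Sum>e\<in>{e\<in>?\<Phi> ` H. fst e = j}. f e) - (\<Sum>e\<in>{e\<in>?\<Phi> ` H. snd e = j}. f e)
        = real (a ! (j - 1))) \<longleftrightarrow>
      (\<forall>i\<in>{1..m}. (\<Sum>e\<in>{e\<in>H. fst e = i}. f (?\<Phi> e)) - (\<Sum>e\<in>{e\<in>H. snd e = i}. f (?\<Phi> e))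
        = real (b ! (i - 1)))" (is "(\<forall>j\<in>_. ?P j) \<longleftrightarrow> (\<forall>i\<in>_. ?Q i)") for f :: "nat \<times> nat \<Rightarrow> real"
  proof -
    have PQ: "?P (\<phi> i) \<longleftrightarrow> ?Q i" if "i \<in> {1..m}" for i
      by (simp only: fst_sum[OF that] snd_sum[OF that] ab[OF that])
    \<comment> \<open>At a skipped vertex both sums are empty and the entry is 0.\<close>
    have "?P j" if "j \<in> {1..n} - \<phi> ` {1..m}" for j
    proof -
      have "j \<notin> \<phi> ` {1..m+1}" using img that by auto
      then have no: "{e\<in>?\<Phi> ` H. fst e = j} = {}" "{e\<in>?\<Phi> ` H. snd e = j} = {}"
        using HV by fastforce+
      show ?thesis unfolding no using zero[OF that] by simp
    qed
    then show ?thesis using PQ im by blast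
  qed
  show ?thesis
  proof
    assume "valid n a (?\<Phi> ` H)"
    then obtain f where "\<forall>e\<in>?\<Phi> ` H. 0 < f e" "\<forall>j\<in>{1..n}. (\<Sum>e\<in>{e\<in>?\<Phi> ` H. fst e = j}. f e)
        - (\<Sum>e\<in>{e\<in>?\<Phi> ` H. snd e = j}. f e) = real (a ! (j - 1))"
      unfolding valid_iff by blast
    then show "valid m b H" unfolding cons valid_iff
      using H by (intro conjI exI[of _ "\<lambda>e. f (?\<Phi> e)"]) auto
  next
    assume "valid m b H"
    then obtain g where g: "\<forall>e\<in>H. 0 < g e" "\<forall>i\<in>{1..m}. (\<Sum>e\<in>{e\<in>H. fst e = i}. g e)
        - (\<Sum>e\<in>{e\<in>H. snd e = i}. g e) = real (b ! (i - 1))"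
      unfolding valid_iff by blast
    \<comment> \<open>Transport of \<open>g\<close> along the injective edge map; values off the
      image of \<open>H\<close> are arbitrary and never enter the sums.\<close>
    define f where "f = g \<circ> inv_into H ?\<Phi>"
    have fg: "f (?\<Phi> e) = g e" if "e \<in> H" for e using injH that by (simp add: f_def)
    have "\<forall>e\<in>?\<Phi> ` H. 0 < f e" using fg g(1) by auto
    moreover have "(\<Sum>e\<in>{e\<in>H. fst e = i}. f (?\<Phi> e)) = (\<Sum>e\<in>{e\<in>H. fst e = i}. g e)"
      "(\<Sum>e\<in>{e\<in>H. snd e = i}. f (?\<Phi> e)) = (\<Sum>e\<in>{e\<in>H. snd e = i}. g e)" for i
      using fg by (auto intro: sum.cong)
    ultimately show "valid n a (?\<Phi> ` H)"
      unfolding valid_iff using K g(2) cons[of f] by (intro conjI exI[of _ f]) simp_all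
  qed
qed

lemma verts_map_prod: "verts (map_prod \<phi> \<phi> ` H) = \<phi> ` verts H"
  by (simp add: verts_def image_Un image_image)

lemma nths_relabel:
  fixes a :: "'a list" and Z :: "nat set"
  defines "m \<equiv> length (nths a (- Z))"
  obtains \<phi> where "strict_mono_on {1..m+1} \<phi>" "\<phi> ` {1..m} = {j \<in> {1..length a}. j - 1 \<notin> Z}"
    "\<phi> (m + 1) = length a + 1" "\<And>i. i \<in> {1..m} \<Longrightarrow> a ! (\<phi> i - 1) = nths a (- Z) ! (i - 1)"
proof -
  \<comment> \<open>The retained positions of \<open>a\<close>, 0-based and in increasing
    order.\<close>
  define L where "L = nths [0..<length a] (- Z)"
  have aL: "nths a (- Z) = map ((!) a) L"
    unfolding L_def nths_map[symmetric] map_nth ..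
  then have mL: "length L = m" by (simp add: m_def)
  have sL: "sorted_wrt (<) L" unfolding L_def
    by (simp add: strict_sorted_iff sorted_nths distinct_nthsI)
  have setL: "set L = {j. j < length a \<and> j \<notin> Z}"
    unfolding L_def set_nths by (force simp: nth_upt)
  \<comment> \<open>Vertices are numbered from 1 and list positions from 0, hence the shifts by one;
    the last vertex is sent to the sink.\<close>
  define \<phi> where "\<phi> i = (if i = m + 1 then length a + 1 else L ! (i - 1) + 1)" for i
  have nL: "L ! (i - 1) < length a" if "i \<in> {1..m}" for i
  proof -
    have "L ! (i - 1) \<in> set L" using that mL by (intro nth_mem) auto
    then show ?thesis using setL by simp
  qed
  show thesis
  proof
    show "strict_mono_on {1..m+1} \<phi>"
    proof (rule strict_mono_onI)
      fix i j assume ij: "i \<in> {1..m+1}" "j \<in> {1..m+1}" "i < j"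
      then have i: "i \<in> {1..m}" by auto
      show "\<phi> i < \<phi> j"
      proof (cases "j = m + 1")
        case True
        then show ?thesis using i nL[OF i] by (auto simp: \<phi>_def)
      next
        case False
        then have "L ! (i - 1) < L ! (j - 1)" 
          using sL ij mL by (intro sorted_wrt_nth_less[of "(<)"]) auto
        then show ?thesis using False i by (auto simp: \<phi>_def)
      qed
    qed
    have "\<phi> ` {1..m} = (\<lambda>i. L ! i + 1) ` (\<lambda>i. i - 1) ` {1..m}"
      unfolding image_image by (rule image_cong) (auto simp: \<phi>_def)
    also have "(\<lambda>i. i - 1) ` {1..m} = {0..<length L}"
      unfolding mL by (auto simp: image_iff intro!: bexI[of _ "Suc _"])
    also have "(\<lambda>i. L ! i + 1) ` {0..<length L} = Suc ` set L"
      by (simp add: set_conv_nth image_def) (auto intro: atLeastLessThan_iff[THEN iffD2])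
    also have "\<dots> = {j \<in> {1..length a}. j - 1 \<notin> Z}"
    proof (intro equalityI subsetI)
      fix j assume "j \<in> {j \<in> {1..length a}. j - 1 \<notin> Z}"
      then have "j - 1 \<in> set L" "j = Suc (j - 1)" by (auto simp: setL)
      then show "j \<in> Suc ` set L" by blast
    qed (auto simp: setL)
    finally show "\<phi> ` {1..m} = {j \<in> {1..length a}. j - 1 \<notin> Z}" .
    show "\<phi> (m + 1) = length a + 1" by (simp add: \<phi>_def)
    show "a ! (\<phi> i - 1) = nths a (- Z) ! (i - 1)" if "i \<in> {1..m}" for i
      using that mL by (auto simp: aL \<phi>_def)
  qed
qed

text \<open>Taking images under the relabelling is a bijection from the primitive valid subgraphs
  for the shortened vector to the valid subgraphs with the prescribed vertex set. It preserves the
  numbers of edges and vertices, and all these graphs are connected, so the Betti numbers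
  agree.\<close>

lemma sum_valid_on_vertex_set:
  assumes n: "n \<ge> 1" "length a = n" "a ! 0 \<noteq> 0" and Z: "Z \<subseteq> zero_positions a"
  shows "(\<Sum>H\<in>{H. valid n a H \<and> verts H = {j \<in> {1..n}. j - 1 \<notin> Z} \<union> {n + 1}}.
            Poly_Mapping.single (betti H) 1)
       = prim_f_poly (length (nths a (- Z))) (nths a (- Z))" (is "sum _ ?A = _")
proof -
  define b m where "b = nths a (- Z)" and "m = length b"
  obtain \<phi> where \<phi>: "strict_mono_on {1..m+1} \<phi>" "\<phi> ` {1..m} = {j \<in> {1..n}. j - 1 \<notin> Z}"
    "\<phi> (m + 1) = n + 1" and ab: "\<And>i. i \<in> {1..m} \<Longrightarrow> a ! (\<phi> i - 1) = b ! (i - 1)"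
    unfolding m_def b_def using nths_relabel[of a Z] unfolding n(2) by blast
  let ?\<Phi> = "map_prod \<phi> \<phi>" and ?B = "{H. valid m b H \<and> primitive m H}"
  have "{1..m+1} = insert (m + 1) {1..m}" by auto
  then have img: "\<phi> ` {1..m+1} = {j \<in> {1..n}. j - 1 \<notin> Z} \<union> {n + 1}"
    using \<phi>(2,3) by simp
  have inj: "inj_on \<phi> {1..m+1}" using \<phi>(1) by (rule strict_mono_on_imp_inj_on)
  have zero: "a ! (j - 1) = 0" if "j \<in> {1..n} - \<phi> ` {1..m}" for j
    using that Z \<phi>(2) by (auto simp: zero_positions_def)
  have rel: "valid n a (?\<Phi> ` H) \<longleftrightarrow> valid m b H" if "H \<subseteq> K_edges m" for H
    using \<phi>(1) _ \<phi>(3) ab zero that by (rule valid_relabel) (use img in auto)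
  have KS: "H \<subseteq> {1..m+1} \<times> {1..m+1}" if "valid m b H" for H
    using valid_subset[OF that] by (auto simp: K_edges_def)
  have injP: "inj_on ?\<Phi> ({1..m+1} \<times> {1..m+1})" using map_prod_inj_on[OF inj inj] .
  have "inj_on ((`) ?\<Phi>) ?B"
    using KS by (intro inj_on_subset[OF inj_on_image_Pow[OF injP]]) auto
  moreover have "(`) ?\<Phi> ` ?B = ?A"
  proof (intro equalityI subsetI)
    fix H assume "H \<in> (`) ?\<Phi> ` ?B"
    then obtain H' where H': "H = ?\<Phi> ` H'" "valid m b H'" "verts H' = {1..m+1}"
      by (auto simp: primitive_def)
    moreover have "valid n a H"
      unfolding H'(1) by (rule rel[THEN iffD2, OF valid_subset[OF H'(2)] H'(2)])
    moreover have "verts H = \<phi> ` {1..m+1}"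
      unfolding H'(1) verts_map_prod H'(3) ..
    ultimately show "H \<in> ?A" unfolding img by blast
  next
    fix H assume H: "H \<in> ?A"
    \<comment> \<open>The preimage of \<open>H\<close> under the edge map. No edge of
      \<open>H\<close> is lost, since all its endpoints lie in the range of
      \<open>\<phi>\<close>.\<close>
    define H' where "H' = {e \<in> {1..m+1} \<times> {1..m+1}. ?\<Phi> e \<in> H}"
    have HH': "H = ?\<Phi> ` H'"
    proof -
      have "H \<subseteq> ?\<Phi> ` ({1..m+1} \<times> {1..m+1})"
      proof
        fix e assume "e \<in> H"
        then have "fst e \<in> verts H" "snd e \<in> verts H" by (simp_all add: verts_def)
        then have "fst e \<in> \<phi> ` {1..m+1}" "snd e \<in> \<phi> ` {1..m+1}" using H img by simp_all
        then show "e \<in> ?\<Phi> ` ({1..m+1} \<times> {1..m+1})"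
          unfolding map_prod_surj_on[OF refl refl] by (simp add: mem_Times_iff)
      qed
      moreover have "f ` {x \<in> A. f x \<in> B} = B" if "B \<subseteq> f ` A"
        for f :: "nat \<times> nat \<Rightarrow> nat \<times> nat" and A B using that by blast
      ultimately show ?thesis unfolding H'_def by metis
    qed
    have K: "H' \<subseteq> K_edges m"
    proof
      fix e assume e: "e \<in> H'"
      obtain i j where ij: "e = (i, j)" by force
      have r: "i \<in> {1..m+1}" "j \<in> {1..m+1}" and "(\<phi> i, \<phi> j) \<in> H" using e ij by (auto simp: H'_def)
      \<comment> \<open>A strictly increasing map also reflects the order, so edges of
        \<open>H\<close> pull back to edges of \<open>K_edges m\<close>.\<close>
      then have "\<phi> i < \<phi> j" using H valid_subset[of n a H] by (auto simp: K_edges_def)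
      then have "i < j" using strict_mono_on_less[OF \<phi>(1)] r by blast
      then show "e \<in> K_edges m" using r ij by (auto simp: K_edges_def)
    qed
    then have val: "valid m b H'" using rel[OF K] H HH' by auto
    have "\<phi> ` verts H' = \<phi> ` {1..m+1}" using H HH' img by (auto simp: verts_map_prod)
    then have "verts H' = {1..m+1}"
      using inj_on_image_eq_iff[OF inj verts_subset[OF K] order_refl] by blast
    then have "primitive m H'" using valid_connected[OF val] by (auto simp: primitive_def)
    then show "H \<in> (`) ?\<Phi> ` ?B" using val HH' by auto
  qed
  ultimately have bij: "bij_betw ((`) ?\<Phi>) ?B ?A" by (simp add: bij_betw_def)
  have "betti (?\<Phi> ` H) = betti H" if H: "H \<in> ?B" for H
  proof -
    have K: "H \<subseteq> K_edges m" using H valid_subset by blast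
    have "card (?\<Phi> ` H) = card H"
      using inj_on_subset[OF injP KS] H by (auto intro: card_image)
    moreover have "card (\<phi> ` verts H) = card (verts H)"
      using inj_on_subset[OF inj verts_subset[OF K]] by (rule card_image)
    moreover have "valid n a (?\<Phi> ` H)" using rel[OF K] H by simp
    \<comment> \<open>Connectedness comes from validity for the image and from primitivity for
      \<open>H\<close>.\<close>
    ultimately show ?thesis
      using betti_valid[OF _ n(1,3)] betti_primitive[of m H] H by (simp add: verts_map_prod)
  qed
  then have "(\<Sum>H\<in>?B. Poly_Mapping.single (betti (?\<Phi> ` H)) (1::int)) = prim_f_poly m b"
    by (simp add: prim_f_poly_def)
  then show ?thesis
    using sum.reindex_bij_betw[OF bij, of "\<lambda>H. Poly_Mapping.single (betti H) (1::int)"]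
    by (simp add: m_def b_def)
qed

section \<open>Grouping the valid subgraphs by the vertices they miss\<close>

theorem lemma3p7:
  fixes n :: nat and a :: "nat list"
  assumes "n \<ge> 1" and "length a = n" and "a ! 0 \<noteq> 0"
  shows "f_poly n a = Poly_Mapping.single (-1) 1
           + (\<Sum>b\<in>{b. b \<le>\<^sub>c a}. of_nat (del_mult a b) * prim_f_poly (length b) b)"
proof -
  let ?P = "Pow (zero_positions a)" and ?S = "\<lambda>H. Poly_Mapping.single (betti H) (1::int)"
  let ?V = "\<lambda>Z. {j \<in> {1..n}. j - 1 \<notin> Z} \<union> {n + 1}"
  \<comment> \<open>The missed vertices other than the sink, as 0-based positions: position
    \<open>i\<close> belongs to vertex \<open>i + 1\<close>. Conversely, \<open>?V Z\<close> is the
    vertex set that misses exactly the positions in \<open>Z\<close>.\<close>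
  let ?Z = "\<lambda>H. {i. i < n \<and> i + 1 \<notin> verts H}"
  have finP: "finite ?P" by (simp add: zero_positions_def)
  have Z: "?Z H \<in> ?P" if "valid n a H" for H
  proof -
    have "a ! i = 0" if "i < n" "i + 1 \<notin> verts H" for i
      using valid_support_vertex[OF \<open>valid n a H\<close>, of "i + 1"] that by auto
    then show ?thesis using assms(2) by (auto simp: zero_positions_def)
  qed
  \<comment> \<open>The sink always lies in \<open>verts H\<close>, so the vertex set is determined
    by which of the vertices \<open>1\<close> to \<open>n\<close> are missed.\<close>
  have V: "?Z H = Z \<longleftrightarrow> verts H = ?V Z" if H: "valid n a H" and "Z \<in> ?P" for H Z
  proof -
    have sub: "Z \<subseteq> {..<n}" using that(2) assms(2) by (auto simp: zero_positions_def)
    have v: "n + 1 \<in> verts H" "verts H \<subseteq> {1..n+1}"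
      using sink_in_verts[OF H assms(1,3)] verts_subset[OF valid_subset[OF H]] by auto
    show ?thesis
    proof
      assume eq: "?Z H = Z"
      show "verts H = ?V Z"
        unfolding eq[symmetric] using v by (auto simp: le_Suc_eq Suc_le_eq subset_iff)
    next
      assume "verts H = ?V Z" then show "?Z H = Z" using sub by auto
    qed
  qed
  \<comment> \<open>First grouping: by the set of missed positions, which consists of zero entries
    by \<open>Z\<close>.\<close>
  have "(\<Sum>H\<in>{H. valid n a H}. ?S H)
      = (\<Sum>Z\<in>?P. \<Sum>H\<in>{H \<in> {H. valid n a H}. ?Z H = Z}. ?S H)"
    using finite_valid finP Z by (intro sum.group[symmetric]) auto
  also have "\<dots> = (\<Sum>Z\<in>?P. prim_f_poly (length (nths a (- Z))) (nths a (- Z)))"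
  proof (rule sum.cong[OF refl])
    fix Z assume Zp: "Z \<in> ?P"
    then have "{H \<in> {H. valid n a H}. ?Z H = Z} = {H. valid n a H \<and> verts H = ?V Z}"
      using V by blast
    then show "(\<Sum>H\<in>{H \<in> {H. valid n a H}. ?Z H = Z}. ?S H)
        = prim_f_poly (length (nths a (- Z))) (nths a (- Z))"
      using sum_valid_on_vertex_set[OF assms] Zp by simp
  qed
  \<comment> \<open>Second grouping: by the vector left after deletion. The summand depends on
    \<open>Z\<close> only through that vector, so each fibre contributes its cardinality
    \<open>del_mult a b\<close> as a factor.\<close>
  also have "\<dots> = (\<Sum>b\<in>{b. b \<le>\<^sub>c a}. \<Sum>Z\<in>{Z \<in> ?P. nths a (- Z) = b}.
      prim_f_poly (length (nths a (- Z))) (nths a (- Z)))"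
  proof (rule sum.group[symmetric])
    have "{b. b \<le>\<^sub>c a} = (\<lambda>Z. nths a (- Z)) ` ?P" by (auto simp: del_le_def)
    then show "finite {b. b \<le>\<^sub>c a}" "(\<lambda>Z. nths a (- Z)) ` ?P \<subseteq> {b. b \<le>\<^sub>c a}"
      using finP by auto
  qed (rule finP)
  also have "\<dots> = (\<Sum>b\<in>{b. b \<le>\<^sub>c a}. of_nat (del_mult a b) * prim_f_poly (length b) b)"
  proof (rule sum.cong[OF refl])
    fix b
    have "(\<Sum>Z\<in>{Z \<in> ?P. nths a (- Z) = b}. prim_f_poly (length (nths a (- Z))) (nths a (- Z)))
        = (\<Sum>Z\<in>{Z \<in> ?P. nths a (- Z) = b}. prim_f_poly (length b) b)" by (rule sum.cong) auto
    then show "(\<Sum>Z\<in>{Z \<in> ?P. nths a (- Z) = b}. prim_f_poly (length (nths a (- Z))) (nths a (- Z)))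
        = of_nat (del_mult a b) * prim_f_poly (length b) b"
      by (simp add: del_mult_def)
  qed
  finally show ?thesis using f_poly_eq_sum_valid[OF assms(1,3)] by simp
qed

end
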